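(* Let $a\in\mathbb{R}$ and let $\varphi:[a,+\infty)\to\mathbb{R}$ be a continuous monotone increasing function such that $$\varphi(s)>0\ \text{ for all } s\ge a\qquad\text{and}\qquad \int_a^{+\infty}\frac{ds}{\varphi(s)}=+\infty.$$ If a $C^1$ function $v_0=v_0(t)$ satisfies $$v_0'(t)=\varphi(v_0(t))\quad\text{with } v_0(0)\ge a,$$ and it is inextensible (as a solution of this equation), then it is defined for all $t\ge 0$. Furthermore, for such a $v_0$, if $v:[0,b)\to\mathbb{R}$ is a continuous function such that $$a\ \le\ v(t)\ \le\ v(0)+\int_0^t\varphi(v(s))\,ds\quad\text{for all } t\in[0,b),\qquad\text{and}\qquad v(0)\le v_0(0),$$ then $v(t)\le v_0(t)$ for all $t\in[0,b)$.
   Context: A solution is inextensible if it is defined on a maximal interval, i.e. it cannot be extended as a solution to a strictly larger interval. *)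

theory Defs
  imports "HOL-Analysis.Analysis"
begin

text \<open>A \<open>C\<^sup>1\<close> solution of \<open>x' = f x\<close>, for \<open>f\<close> given on the set \<open>D\<close>, on a nondegenerate
  interval \<open>I\<close>. If \<open>I\<close> contains an endpoint, the derivative there is one-sided. The equation
  only makes sense where the solution stays in \<open>D\<close>, so this is part of being a solution.
  The continuity condition says that the derivative is continuous.\<close>

definition ode_solution ::
  "real set \<Rightarrow> (real \<Rightarrow> real) \<Rightarrow> real set \<Rightarrow> (real \<Rightarrow> real) \<Rightarrow> bool" where
  "ode_solution D f I x \<longleftrightarrow>
     is_interval I \<and> interior I \<noteq> {} \<and> x ` I \<subseteq> D \<and>
     (\<forall>t\<in>I. (x has_real_derivative f (x t)) (at t within I)) \<and>
     continuous_on I (\<lambda>t. f (x t))"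

definition inextensible_solution ::
  "real set \<Rightarrow> (real \<Rightarrow> real) \<Rightarrow> real set \<Rightarrow> (real \<Rightarrow> real) \<Rightarrow> bool" where
  "inextensible_solution D f I x \<longleftrightarrow>
     ode_solution D f I x \<and>
     \<not> (\<exists>J y. I \<subset> J \<and> ode_solution D f J y \<and> (\<forall>t\<in>I. y t = x t))"

end

theory Submission
  imports Defs
begin

text \<open>Separate variables. If \<open>F\<close> is a primitive of \<open>1 / \<phi>\<close>, then \<open>F (v\<^sub>0 t) - t\<close> is constant
  along a solution. Since \<open>F\<close> maps \<open>[a, \<infinity>)\<close> onto \<open>[F a, \<infinity>)\<close>, its inverse \<open>G\<close> gives the solution
  \<open>t \<mapsto> G (F (v\<^sub>0 0) + t)\<close> on \<open>[F a - F (v\<^sub>0 0), \<infinity>)\<close>, which extends \<open>v\<^sub>0\<close> and so has the same domain.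
  For the comparison, the right-hand side \<open>w\<close> of the integral inequality satisfies
  \<open>w' = \<phi> (v) \<le> \<phi> (w)\<close>, so \<open>F (w t) - t\<close> is nonincreasing, and \<open>v \<le> w \<le> v\<^sub>0\<close>.\<close>

text \<open>Extending \<open>\<phi>\<close> by the constant \<open>\<phi> a\<close> to the left of \<open>a\<close> makes the primitive and its inverse
  differentiable in the two-sided sense at \<open>a\<close> too.\<close>

lemma reciprocal_primitive:
  fixes a :: real and \<phi> :: "real \<Rightarrow> real"
  assumes cont: "continuous_on {a..} \<phi>"
    and pos: "\<forall>s\<ge>a. \<phi> s > 0"
    and div: "filterlim (\<lambda>x. integral {a..x} (\<lambda>s. 1 / \<phi> s)) at_top at_top"
  obtains F G :: "real \<Rightarrow> real" where
    "\<And>x. x \<ge> a \<Longrightarrow> (F has_real_derivative 1 / \<phi> x) (at x)"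
    "strict_mono F"
    "\<And>x. G (F x) = x"
    "\<And>y. y \<ge> F a \<Longrightarrow> a \<le> G y \<and> F (G y) = y"
    "\<And>y. y \<ge> F a \<Longrightarrow> (G has_real_derivative \<phi> (G y)) (at y)"
proof -
  define h where "h = (\<lambda>x. \<phi> (max a x))"
  have h_pos: "h x > 0" for x
    using pos by (simp add: h_def)
  have h_cont: "continuous_on UNIV h"
    unfolding h_def
    by (rule continuous_on_compose2[OF cont]) (auto intro!: continuous_intros)
  have inv_cont: "continuous_on UNIV (\<lambda>x. 1 / h x)"
    using h_cont h_pos by (intro continuous_intros) (auto simp: less_le)
  then have "isCont (\<lambda>x. 1 / h x) x" for x
    by (simp add: continuous_on_eq_continuous_at)
  then obtain F where "\<And>x. (F has_vector_derivative 1 / h x) (at x)"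
    using einterval_antiderivative[of "-\<infinity>" "\<infinity>" "\<lambda>x. 1 / h x"] by auto
  then have F_deriv: "(F has_real_derivative 1 / h x) (at x)" for x
    by (simp add: has_real_derivative_iff_has_vector_derivative)
  have F_cont: "continuous_on S F" for S
    by (meson DERIV_isCont F_deriv continuous_at_imp_continuous_on)
  have F_mono: "strict_mono F"
  proof (rule strict_monoI)
    fix x y :: real
    assume "x < y"
    then show "F x < F y"
      by (rule DERIV_pos_imp_increasing) (use F_deriv h_pos in force)
  qed
  define G where "G = inv F"
  have GF: "G (F x) = x" for x
    unfolding G_def by (simp add: inv_f_f F_mono strict_mono_imp_inj_on)
  have F_int: "integral {a..x} (\<lambda>s. 1 / \<phi> s) = F x - F a" if "a \<le> x" for x
  proof -
    have "((\<lambda>s. 1 / \<phi> s) has_integral F x - F a) {a..x}"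
    proof (rule fundamental_theorem_of_calculus[OF that])
      fix s assume "s \<in> {a..x}"
      then show "(F has_vector_derivative 1 / \<phi> s) (at s within {a..x})"
        using has_field_derivative_at_within[OF F_deriv[of s]]
        by (auto simp: h_def max_def has_real_derivative_iff_has_vector_derivative
            split: if_splits)
    qed
    then show ?thesis by (rule integral_unique)
  qed
  \<comment> \<open>Divergence of the integral makes \<open>F\<close> reach at least
    \<open>y\<close> somewhere to the right of \<open>a\<close>. The intermediate value theorem then
    gives a preimage of \<open>y\<close> in \<open>{a..}\<close>, which must be \<open>G y\<close>
    by \<open>GF\<close>.\<close>
  have onto: "a \<le> G y \<and> F (G y) = y" if y: "y \<ge> F a" for y
  proof -
    have "\<forall>\<^sub>F x in at_top. y - F a \<le> integral {a..x} (\<lambda>s. 1 / \<phi> s) \<and> a \<le> x"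
      using div by (auto simp: filterlim_at_top intro: eventually_conj eventually_ge_at_top)
    then obtain x where "y - F a \<le> integral {a..x} (\<lambda>s. 1 / \<phi> s)" "a \<le> x"
      by (metis (mono_tags, lifting) eventually_happens trivial_limit_at_top_linorder)
    then have "a \<le> x" "y \<le> F x"
      using F_int by auto
    with y obtain z where "a \<le> z" "F z = y"
      using IVT'[of F a y x] F_cont by blast
    then show ?thesis using GF by auto
  qed
  have G_deriv: "(G has_real_derivative \<phi> (G y)) (at y)" if y: "y \<ge> F a" for y
  proof -
    \<comment> \<open>Inverse function rule on the open set \<open>UNIV\<close>: thanks to the
      extension \<open>h\<close>, it applies even when \<open>G y = a\<close>. Multiplication by
      \<open>1 / h (G y)\<close> is inverted by multiplication by \<open>h (G y)\<close>.\<close>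
    have "(G has_derivative (*) (h (G y))) (at (F (G y)))"
      by (rule has_derivative_inverse_strong[where S = UNIV and f' = "(*) (1 / h (G y))"])
        (use F_deriv[of "G y"] h_pos[of "G y"] F_cont GF in
          \<open>auto simp: has_field_derivative_def o_def\<close>)
    then show ?thesis
      using onto[OF y] by (simp add: has_field_derivative_def h_def max_def)
  qed
  have "(F has_real_derivative 1 / \<phi> x) (at x)" if "x \<ge> a" for x
    using F_deriv[of x] that by (simp add: h_def max_def)
  then show thesis
    using that F_mono GF onto G_deriv by blast
qed

text \<open>By the chain rule, \<open>F (x t) - t\<close> has derivative
  \<open>\<phi> (x t) / \<phi> (x t) - 1 = 0\<close>. Derivatives are taken within \<open>I\<close>,
  so that endpoints belonging to \<open>I\<close> are covered too.\<close>

lemma ode_solution_separation: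
  assumes sol: "ode_solution {a..} \<phi> I x"
    and pos: "\<forall>s\<ge>a. \<phi> s > 0"
    and F: "\<And>s. s \<ge> a \<Longrightarrow> (F has_real_derivative 1 / \<phi> s) (at s)"
    and "s \<in> I" "t \<in> I"
  shows "F (x t) - F (x s) = t - s"
proof -
  have "\<exists>c. \<forall>t\<in>I. F (x t) - t = c"
  proof (rule has_field_derivative_zero_constant)
    show "convex I"
      using sol by (simp add: ode_solution_def is_interval_convex)
    fix t assume "t \<in> I"
    then have "x t \<ge> a" "(x has_real_derivative \<phi> (x t)) (at t within I)"
      using sol by (auto simp: ode_solution_def)
    with pos F[of "x t"] show "((\<lambda>t. F (x t) - t) has_real_derivative 0) (at t within I)"
      by (auto intro!: derivative_eq_intros DERIV_chain'[where g = F and f = x])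
  qed
  then obtain c where c: "\<And>t. t \<in> I \<Longrightarrow> F (x t) - t = c"
    by blast
  show ?thesis
    using c[OF \<open>s \<in> I\<close>] c[OF \<open>t \<in> I\<close>] by linarith
qed

text \<open>Since \<open>v\<close> is only assumed continuous, \<open>F (v t)\<close> need not be
  differentiable. The majorant \<open>w\<close> is differentiable, has the same initial value, and
  stays in \<open>{a..}\<close>, where \<open>F\<close> is a primitive.\<close>

lemma integral_inequality_comparison:
  fixes a T :: real
  assumes cont: "continuous_on {a..} \<phi>"
    and mono: "mono_on {a..} \<phi>"
    and pos: "\<forall>s\<ge>a. \<phi> s > 0"
    and F: "\<And>s. s \<ge> a \<Longrightarrow> (F has_real_derivative 1 / \<phi> s) (at s)"
    and F_mono: "strict_mono F"
    and "0 \<le> T"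
    and v_cont: "continuous_on {0..T} v"
    and v_ge: "\<And>t. t \<in> {0..T} \<Longrightarrow> a \<le> v t"
    and v_le: "\<And>t. t \<in> {0..T} \<Longrightarrow> v t \<le> v 0 + integral {0..t} (\<lambda>s. \<phi> (v s))"
  shows "F (v T) \<le> F (v 0) + T"
proof -
  define w where "w = (\<lambda>t. v 0 + integral {0..t} (\<lambda>s. \<phi> (v s)))"
  have "continuous_on {0..T} (\<lambda>s. \<phi> (v s))"
    by (rule continuous_on_compose2[OF cont v_cont]) (use v_ge in auto)
  then have w_deriv: "(w has_real_derivative \<phi> (v t)) (at t within {0..T})"
    if "t \<in> {0..T}" for t
    unfolding w_def using that
    by (auto intro!: derivative_eq_intros integral_has_real_derivative)
  have vw: "a \<le> v t" "v t \<le> w t" if "t \<in> {0..T}" for t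
    using v_ge v_le that by (auto simp: w_def)
  have Fw_deriv: "((\<lambda>t. F (w t) - t) has_real_derivative \<phi> (v t) / \<phi> (w t) - 1) (at t within {0..T})"
    if "t \<in> {0..T}" for t
    using w_deriv[OF that] F[of "w t"] vw[OF that]
    by (auto intro!: derivative_eq_intros DERIV_chain'[where g = F and f = w])
  have "F (w T) - T \<le> F (w 0) - 0"
  proof (rule DERIV_nonpos_imp_decreasing_open[OF \<open>0 \<le> T\<close>, of "\<lambda>t. F (w t) - t"])
    show "continuous_on {0..T} (\<lambda>t. F (w t) - t)"
      by (rule DERIV_continuous_on[OF Fw_deriv])
    fix t assume t: "0 < t" "t < T"
    \<comment> \<open>Here monotonicity of \<open>\<phi>\<close> turns
      \<open>a \<le> v t \<le> w t\<close> into a bound on the derivative of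
      \<open>w\<close>.\<close>
    then have "\<phi> (v t) \<le> \<phi> (w t)" "\<phi> (w t) > 0"
      using vw[of t] pos mono by (auto intro: mono_onD)
    then have "\<phi> (v t) / \<phi> (w t) - 1 \<le> 0"
      by simp
    moreover have "((\<lambda>t. F (w t) - t) has_real_derivative \<phi> (v t) / \<phi> (w t) - 1) (at t)"
      using Fw_deriv[of t] t at_within_Icc_at[of 0 t T] by simp
    ultimately show "\<exists>d. ((\<lambda>t. F (w t) - t) has_real_derivative d) (at t) \<and> d \<le> 0"
      by blast
  qed
  moreover have "F (v T) \<le> F (w T)"
    using vw[of T] \<open>0 \<le> T\<close> F_mono by (simp add: strict_mono_less_eq)
  moreover have "w 0 = v 0"
    by (simp add: w_def)
  ultimately show ?thesis by simp
qed

theorem lemma2p2: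
  fixes a :: real and \<phi> v\<^sub>0 :: "real \<Rightarrow> real" and I :: "real set"
  assumes "continuous_on {a..} \<phi>"
    and "mono_on {a..} \<phi>"
    and "\<forall>s\<ge>a. \<phi> s > 0"
    and "filterlim (\<lambda>x. integral {a..x} (\<lambda>s. 1 / \<phi> s)) at_top at_top"
    and "inextensible_solution {a..} \<phi> I v\<^sub>0"
    and "0 \<in> I" and "v\<^sub>0 0 \<ge> a"
  shows "{0..} \<subseteq> I \<and>
    (\<forall>(b::ereal) (v :: real \<Rightarrow> real).
       0 < b \<longrightarrow>
       continuous_on {t. 0 \<le> t \<and> ereal t < b} v \<longrightarrow>
       (\<forall>t. 0 \<le> t \<and> ereal t < b \<longrightarrow>
          a \<le> v t \<and> v t \<le> v 0 + integral {0..t} (\<lambda>s. \<phi> (v s))) \<longrightarrow>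
       v 0 \<le> v\<^sub>0 0 \<longrightarrow>
       (\<forall>t. 0 \<le> t \<and> ereal t < b \<longrightarrow> v t \<le> v\<^sub>0 t))"
proof -
  obtain F G where F: "\<And>x. x \<ge> a \<Longrightarrow> (F has_real_derivative 1 / \<phi> x) (at x)"
    and F_mono: "strict_mono F"
    and GF: "\<And>x. G (F x) = x"
    and FG: "\<And>y. y \<ge> F a \<Longrightarrow> a \<le> G y \<and> F (G y) = y"
    and G: "\<And>y. y \<ge> F a \<Longrightarrow> (G has_real_derivative \<phi> (G y)) (at y)"
    using reciprocal_primitive[OF assms(1,3,4)] by metis
  have sol: "ode_solution {a..} \<phi> I v\<^sub>0"
    and max: "\<And>J y. I \<subset> J \<Longrightarrow> ode_solution {a..} \<phi> J y \<Longrightarrow> \<exists>t\<in>I. y t \<noteq> v\<^sub>0 t"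
    using assms(5) by (auto simp: inextensible_solution_def)
  have sep: "F (v\<^sub>0 t) = F (v\<^sub>0 0) + t" if "t \<in> I" for t
    using ode_solution_separation[OF sol assms(3) F \<open>0 \<in> I\<close> that] by simp
  \<comment> \<open>By \<open>sep\<close>, a solution must satisfy
    \<open>F (v\<^sub>0 t) = c + t\<close>; solving for the value gives \<open>y\<close>. The set
    \<open>J\<close> consists of the times with \<open>c + t \<ge> F a\<close>, and \<open>y\<close>
    equals \<open>a\<close> at its left endpoint.\<close>
  define c where "c = F (v\<^sub>0 0)"
  define J where "J = {F a - c..}"
  define y where "y = (\<lambda>t. G (c + t))"
  have y_sol: "ode_solution {a..} \<phi> J y"
    unfolding ode_solution_def
  proof (intro conjI ballI)
    show "is_interval J"
      by (simp add: J_def is_interval_ci)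
    show "interior J \<noteq> {}"
      by (simp add: J_def interior_real_atLeast)
    show y_im: "y ` J \<subseteq> {a..}"
      using FG by (auto simp: J_def y_def)
    show "(y has_real_derivative \<phi> (y t)) (at t within J)" if "t \<in> J" for t
    proof -
      have "F a \<le> c + t"
        using that by (simp add: J_def)
      then have "(G has_real_derivative \<phi> (y t)) (at (c + t))"
        using G y_def by simp
      moreover have "((\<lambda>t. c + t) has_real_derivative 1) (at t within J)"
        by (auto intro!: derivative_eq_intros)
      ultimately have "((\<lambda>t. G (c + t)) has_real_derivative \<phi> (y t) * 1) (at t within J)"
        by (rule DERIV_chain2)
      then show ?thesis
        by (simp add: y_def)
    qed
    then have "continuous_on J y"
      by (meson DERIV_continuous_on)
    then show "continuous_on J (\<lambda>t. \<phi> (y t))"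
      using continuous_on_compose2[OF assms(1)] y_im by blast
  qed
  \<comment> \<open>Values of a solution are at least \<open>a\<close>, so
    \<open>c + t = F (v\<^sub>0 t) \<ge> F a\<close> on \<open>I\<close>.\<close>
  have "I \<subseteq> J"
  proof
    fix t assume "t \<in> I"
    then have "a \<le> v\<^sub>0 t"
      using sol by (auto simp: ode_solution_def)
    then have "F a \<le> F (v\<^sub>0 t)"
      using F_mono by (simp add: strict_mono_less_eq)
    then show "t \<in> J"
      using sep[OF \<open>t \<in> I\<close>] by (simp add: J_def c_def)
  qed
  moreover have "y t = v\<^sub>0 t" if "t \<in> I" for t
    using sep[OF that] GF[of "v\<^sub>0 t"] by (simp add: y_def c_def)
  \<comment> \<open>Otherwise \<open>y\<close> on \<open>J\<close> would be a proper extension of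
    \<open>v\<^sub>0\<close>.\<close>
  ultimately have "I = J"
    using max y_sol by blast
  moreover have "F a \<le> c"
    using F_mono assms(7) by (simp add: c_def strict_mono_less_eq)
  ultimately have global: "{0..} \<subseteq> I"
    by (auto simp: J_def)
  have "v t \<le> v\<^sub>0 t"
    if v_cont: "continuous_on {t. 0 \<le> t \<and> ereal t < b} v"
      and v: "\<And>t. 0 \<le> t \<Longrightarrow> ereal t < b \<Longrightarrow>
          a \<le> v t \<and> v t \<le> v 0 + integral {0..t} (\<lambda>s. \<phi> (v s))"
      and le0: "v 0 \<le> v\<^sub>0 0" and t: "0 \<le> t" "ereal t < b"
    for b v t
  proof -
    \<comment> \<open>The comparison is applied on the compact interval \<open>{0..t}\<close>, which
      treats finite and infinite \<open>b\<close> alike.\<close>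
    have sub: "ereal s < b" if "s \<in> {0..t}" for s
      using that t(2) by (metis atLeastAtMost_iff ereal_less_eq(3) le_less_trans)
    have "F (v t) \<le> F (v 0) + t"
    proof (rule integral_inequality_comparison[OF assms(1-3) F F_mono t(1)])
      show "continuous_on {0..t} v"
        by (rule continuous_on_subset[OF v_cont]) (use sub in auto)
    qed (use v sub in auto)
    also have "\<dots> \<le> F (v\<^sub>0 0) + t"
      using F_mono le0 by (simp add: strict_mono_less_eq)
    also have "\<dots> = F (v\<^sub>0 t)"
      using sep[of t] global t(1) by auto
    finally show ?thesis
      using F_mono by (simp add: strict_mono_less_eq)
  qed
  with global show ?thesis by blast
qed

end
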